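(* Let $A$ be a wqo. If $\mathbf{w}(A)$ is infinite then $\mathbf{w}(\mathcal{P}_f(A))\ge 2^{\mathbf{w}(A)}$. If $\mathbf{w}(A)=k<\omega$ then $\mathbf{w}(\mathcal{P}_f(A))\ge \mathbf{w}(\mathcal{P}_f(\Gamma_k))$.
   Context: A quasi-order $(A,\le)$ is a well-quasi-order (wqo) if every infinite sequence $x_0,x_1,\dots$ in $A$ has indices $i<j$ with $x_i\le x_j$. For a wqo $A$, let $\mathrm{Bad}(A)$, $\mathrm{Dec}(A)$, $\mathrm{Inco}(A)$ be the trees of finite bad sequences (sequences with no $i<j$, $x_i\le x_j$), finite strictly decreasing sequences, and finite sequences of pairwise incomparable elements of $A$, respectively; the root is the empty sequence and the children of a sequence are its one-element extensions. These trees are well-founded; the rank of a node $s$ is $r(s)=\sup\{r(t)+1 : t \text{ a child of } s\}$. The maximal order type $\mathbf{o}(A)$, height $\mathbf{h}(A)$ and width $\mathbf{w}(A)$ are the ranks of the roots of $\mathrm{Bad}(A)$, $\mathrm{Dec}(A)$, $\mathrm{Inco}(A)$ respectively. $\mathcal{P}_f(A)$ denotes the set of finite subsets of $A$ ordered by the Hoare embedding: $S\le_H S'$ iff for every $a\in S$ there is $b\in S'$ with $a\le b$. $\Gamma_k$ denotes a $k$-element antichain (so $\mathcal{P}_f(\Gamma_k)$ is the set of subsets of a $k$-element set ordered by inclusion). *)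

theory Defs
  imports Main
begin

definition qo_on :: "'a set \<Rightarrow> ('a \<Rightarrow> 'a \<Rightarrow> bool) \<Rightarrow> bool" where
  "qo_on A le \<longleftrightarrow> (\<forall>x\<in>A. le x x) \<and>
     (\<forall>x\<in>A. \<forall>y\<in>A. \<forall>z\<in>A. le x y \<longrightarrow> le y z \<longrightarrow> le x z)"

definition wqo_on :: "'a set \<Rightarrow> ('a \<Rightarrow> 'a \<Rightarrow> bool) \<Rightarrow> bool" where
  "wqo_on A le \<longleftrightarrow> qo_on A le \<and>
     (\<forall>f::nat \<Rightarrow> 'a. (\<forall>i. f i \<in> A) \<longrightarrow> (\<exists>i j. i < j \<and> le (f i) (f j)))"

text \<open>The tree Inco(A): finite sequences of pairwise incomparable elements.
  Nodes are lists; the root is [] and the children of u are the lists u @ [z].\<close>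

definition inco_tree :: "'a set \<Rightarrow> ('a \<Rightarrow> 'a \<Rightarrow> bool) \<Rightarrow> 'a list set" where
  "inco_tree A le = {xs. set xs \<subseteq> A \<and>
     (\<forall>i j. i < j \<longrightarrow> j < length xs \<longrightarrow> \<not> le (xs ! i) (xs ! j) \<and> \<not> le (xs ! j) (xs ! i))}"

definition Pf :: "'a set \<Rightarrow> 'a set set" where
  "Pf A = {S. finite S \<and> S \<subseteq> A}"

definition hoare :: "('a \<Rightarrow> 'a \<Rightarrow> bool) \<Rightarrow> 'a set \<Rightarrow> 'a set \<Rightarrow> bool" where
  "hoare le S S' \<longleftrightarrow> (\<forall>a\<in>S. \<exists>b\<in>S'. le a b)"

text \<open>Comparison of the rank of the root of a well-founded tree N (a set of lists,
  child relation u \<mapsto> u @ [z]) with the order type of a well-order W.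
  Ordinals are represented by well-orders (Main's BNF well-order library); elements
  x \<in> Field W stand for the initial segment below x, and None stands for W itself.\<close>

definition below :: "'b rel \<Rightarrow> 'b option \<Rightarrow> 'b \<Rightarrow> bool" where
  "below W x y \<longleftrightarrow> y \<in> Field W \<and>
     (case x of None \<Rightarrow> True | Some x' \<Rightarrow> (y, x') \<in> W \<and> y \<noteq> x')"

definition tree_rank_ge :: "'a list set \<Rightarrow> 'b rel \<Rightarrow> bool" where
  "tree_rank_ge N W \<longleftrightarrow> (\<exists>S. ([], None) \<in> S \<and>
     (\<forall>u x y. (u, x) \<in> S \<longrightarrow> below W x y \<longrightarrow>
        (\<exists>z. u @ [z] \<in> N \<and> (u @ [z], Some y) \<in> S)))"

definition tree_rank_le :: "'a list set \<Rightarrow> 'b rel \<Rightarrow> bool" where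
  "tree_rank_le N W \<longleftrightarrow> (\<exists>S. ([], None) \<in> S \<and>
     (\<forall>u x z. (u, x) \<in> S \<longrightarrow> u @ [z] \<in> N \<longrightarrow>
        (\<exists>y. below W x y \<and> (u @ [z], Some y) \<in> S)))"

definition tree_rank_eq :: "'a list set \<Rightarrow> 'b rel \<Rightarrow> bool" where
  "tree_rank_eq N W \<longleftrightarrow> tree_rank_ge N W \<and> tree_rank_le N W"

definition tree_rank_le_tree :: "'a list set \<Rightarrow> 'c list set \<Rightarrow> bool" where
  "tree_rank_le_tree N1 N2 \<longleftrightarrow> (\<exists>S. ([], []) \<in> S \<and>
     (\<forall>u v z. (u, v) \<in> S \<longrightarrow> u @ [z] \<in> N1 \<longrightarrow>
        (\<exists>z'. v @ [z'] \<in> N2 \<and> (u @ [z], v @ [z']) \<in> S)))"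

text \<open>The ordinal 2^otp(W): finite subsets of Field W (finitely supported functions
  Field W \<rightarrow> 2) ordered anti-lexicographically (compare at the W-largest difference).\<close>
definition oexp2 :: "'b rel \<Rightarrow> 'b set rel" where
  "oexp2 W = {(X, Y). finite X \<and> X \<subseteq> Field W \<and> finite Y \<and> Y \<subseteq> Field W \<and>
     (X = Y \<or> (\<exists>y\<in>Y - X. \<forall>z\<in>(X - Y) \<union> (Y - X). (z, y) \<in> W))}"

definition natW :: "nat \<Rightarrow> nat rel" where
  "natW k = {(i, j). i \<le> j \<and> j < k}"

end

theory Submission
  imports Defs "HOL-Library.Multiset_Order"
begin

text \<open>
  Write \<open>w(A) = \<lambda> + n\<close> with \<open>\<lambda>\<close> a limit. An antichain \<open>X\<close> of size \<open>n\<close> can be played so that the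
  set \<open>B\<close> of elements incomparable to \<open>X\<close> still has width at least \<open>\<lambda>\<close>; by induction \<open>P\<^sub>f(B)\<close> has
  width at least \<open>2\<^sup>\<lambda>\<close>. As \<open>2\<^sup>\<lambda>\<close> is additively indecomposable, a subset \<open>D\<close> of \<open>B\<close> that is minimal
  (under removal of principal up-closures) with \<open>w(P\<^sub>f(D)) \<ge> 2\<^sup>\<lambda>\<close> keeps that width when one only
  allows sets that are not dominated by a given finite \<open>T \<subseteq> D\<close>. Hence the \<open>2\<^sup>n\<close> families
  \<open>{S \<union> Y | S \<in> P\<^sub>f(D)}\<close>, \<open>Y \<subseteq> X\<close>, can be played one after the other, which gives \<open>2\<^sup>\<lambda> \<cdot> 2\<^sup>n\<close>. For a
  limit \<open>w(A)\<close> the bound is the supremum of the bounds for the smaller ordinals.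

  Ordinals below a power of two are finite multisets of limit ordinals (with 0): \<open>{#\<lambda>#}\<close> stands
  for \<open>2\<^sup>\<lambda>\<close>, and multiset union is the natural sum.
\<close>

section \<open>Widths via residuals\<close>

text \<open>The continuations of an antichain that starts with \<open>x\<close>: the subtree of
  Inco(A) above [x] is Inco of this set, so widths can be treated on sets instead of lists.\<close>

definition residual :: "('a \<Rightarrow> 'a \<Rightarrow> bool) \<Rightarrow> 'a set \<Rightarrow> 'a \<Rightarrow> 'a set" where
  "residual le A x = {z \<in> A. \<not> le x z \<and> \<not> le z x}"

text \<open>The relation \<open>r\<close> is the strict order on the ordinal notations used for the bound \<open>\<alpha>\<close>.\<close>

inductive width_ge :: "('a \<Rightarrow> 'a \<Rightarrow> bool) \<Rightarrow> ('o \<Rightarrow> 'o \<Rightarrow> bool) \<Rightarrow> 'a set \<Rightarrow> 'o \<Rightarrow> bool"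
  for le r where
  step: "(\<forall>\<beta>. r \<beta> \<alpha> \<longrightarrow> (\<exists>x\<in>A. width_ge le r (residual le A x) \<beta>)) \<Longrightarrow> width_ge le r A \<alpha>"

lemma width_ge_iff:
  "width_ge le r A \<alpha> \<longleftrightarrow> (\<forall>\<beta>. r \<beta> \<alpha> \<longrightarrow> (\<exists>x\<in>A. width_ge le r (residual le A x) \<beta>))"
  by (rule iffI, erule width_ge.cases, simp, rule width_ge.step)

lemma width_geD:
  assumes "width_ge le r A \<alpha>" "r \<beta> \<alpha>"
  obtains x where "x \<in> A" "width_ge le r (residual le A x) \<beta>"
  using assms width_ge_iff by metis

text \<open>A map that preserves incomparability sends the residual of \<open>x\<close> into the
  residual of \<open>f x\<close>, so a strategy on \<open>A\<close> transfers move by move.\<close>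

lemma width_ge_embed:
  assumes "width_ge le r A \<alpha>" "f ` A \<subseteq> B"
    "\<And>x y. x \<in> A \<Longrightarrow> y \<in> A \<Longrightarrow> \<not> le x y \<Longrightarrow> \<not> le y x \<Longrightarrow> \<not> le' (f x) (f y) \<and> \<not> le' (f y) (f x)"
  shows "width_ge le' r B \<alpha>"
  using assms
proof (induction arbitrary: B rule: width_ge.induct)
  case (step \<alpha> A)
  show ?case
  proof (rule width_ge.step, intro allI impI)
    fix \<beta> assume "r \<beta> \<alpha>"
    with step.IH obtain x where x: "x \<in> A"
      and IH: "\<And>B. f ` residual le A x \<subseteq> B \<Longrightarrow>
        (\<And>y z. y \<in> residual le A x \<Longrightarrow> z \<in> residual le A x \<Longrightarrow> \<not> le y z \<Longrightarrow> \<not> le z y \<Longrightarrow>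
          \<not> le' (f y) (f z) \<and> \<not> le' (f z) (f y)) \<Longrightarrow> width_ge le' r B \<beta>"
      by metis
    have "width_ge le' r (residual le' B (f x)) \<beta>"
      using x step.prems by (intro IH) (auto simp: residual_def)
    then show "\<exists>y\<in>B. width_ge le' r (residual le' B y) \<beta>" using x step.prems(1) by blast
  qed
qed

lemma width_ge_mono:
  assumes "width_ge le r A \<alpha>" "A \<subseteq> B"
  shows "width_ge le r B \<alpha>"
  using width_ge_embed[of le r A \<alpha> id B le] assms by simp

lemma residual_mono: "A \<subseteq> B \<Longrightarrow> residual le A x \<subseteq> residual le B x"
  by (auto simp: residual_def)

lemma width_ge_weaken:
  assumes "width_ge le r A \<alpha>" "\<And>\<gamma>. r \<gamma> \<beta> \<Longrightarrow> r \<gamma> \<alpha>"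
  shows "width_ge le r A \<beta>"
  using assms by (subst width_ge_iff) (metis width_ge_iff)

section \<open>Ordinals and their powers of two\<close>

definition least :: "'o::wellorder" where "least = (LEAST x. True)"

lemma least_le: "least \<le> (x::'o::wellorder)"
  unfolding least_def by (rule Least_le) simp

lemma lessThan_eq_least: "{..<x::'o::wellorder} = {least..<x}"
  using least_le by auto

text \<open>The point found is \<mu> + j, reached by j successor steps; the premise on the interval
  keeps them below \<delta>.\<close>

lemma exists_card_atLeastLessThan:
  fixes \<mu> \<delta> :: "'o::wellorder"
  assumes "\<mu> < \<delta>" "finite {\<mu>..<\<delta>} \<Longrightarrow> j < card {\<mu>..<\<delta>}"
  shows "\<exists>\<delta>'. \<mu> \<le> \<delta>' \<and> \<delta>' < \<delta> \<and> finite {\<mu>..<\<delta>'} \<and> card {\<mu>..<\<delta>'} = j"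
  using assms(2)
proof (induction j)
  case 0
  then show ?case using assms(1) by (intro exI[of _ \<mu>]) auto
next
  case (Suc j)
  then obtain x where x: "\<mu> \<le> x" "x < \<delta>" "finite {\<mu>..<x}" "card {\<mu>..<x} = j"
    by (metis Suc_lessD)
  \<comment> \<open>The successor of \<open>x\<close>; if it were \<delta>, the interval up to
    \<delta> would have only \<open>Suc j\<close> elements.\<close>
  define y where "y = (LEAST y. x < y)"
  have xy: "x < y" unfolding y_def by (rule LeastI[of _ \<delta>]) (rule x)
  have ylt: "z \<le> x" if "z < y" for z using that not_less_Least unfolding y_def by fastforce
  have eq: "{\<mu>..<y} = insert x {\<mu>..<x}" using x(1) xy ylt by (auto simp: order.strict_iff_order)
  have "y \<noteq> \<delta>" using Suc.prems eq x by auto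
  moreover have "y \<le> \<delta>" unfolding y_def by (rule Least_le) (rule x)
  ultimately show ?case using eq x xy by (intro exI[of _ y]) auto
qed

text \<open>Here 0 counts as a limit.\<close>

definition limit :: "'o::wellorder \<Rightarrow> bool" where
  "limit \<mu> \<longleftrightarrow> (\<forall>x<\<mu>. infinite {x..<\<mu>})"

text \<open>The \<lambda> in \<delta> = \<lambda> + n: the least point from which \<delta> is
  finitely many steps away. \<open>fin_part\<close> is the n.\<close>

definition lim_part :: "'o::wellorder \<Rightarrow> 'o" where
  "lim_part \<delta> = (LEAST \<mu>. finite {\<mu>..<\<delta>})"

definition fin_part :: "'o::wellorder \<Rightarrow> nat" where
  "fin_part \<delta> = card {lim_part \<delta>..<\<delta>}"

lemma limit_least: "limit least"
  unfolding limit_def using least_le leD by blast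

lemma finite_lim_part: "finite {lim_part \<delta>..<\<delta>}"
  unfolding lim_part_def by (rule LeastI[of _ \<delta>]) simp

lemma lim_part_le: "lim_part \<delta> \<le> \<delta>"
  unfolding lim_part_def by (rule Least_le) simp

lemma lim_part_leI: "finite {\<mu>..<\<delta>} \<Longrightarrow> lim_part \<delta> \<le> \<mu>"
  unfolding lim_part_def by (rule Least_le)

lemma limit_lim_part: "limit (lim_part \<delta>)"
  unfolding limit_def
proof (intro allI impI notI)
  fix x assume x: "x < lim_part \<delta>" "finite {x..<lim_part \<delta>}"
  have "finite {x..<\<delta>}"
    by (rule finite_subset[of _ "{x..<lim_part \<delta>} \<union> {lim_part \<delta>..<\<delta>}"])
      (use x finite_lim_part[of \<delta>] in auto)
  then show False using lim_part_leI x(1) leD by blast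
qed

lemma lim_part_eqI:
  assumes "limit \<mu>" "\<mu> \<le> \<delta>" "finite {\<mu>..<\<delta>}"
  shows "lim_part \<delta> = \<mu>"
proof (rule antisym)
  show "lim_part \<delta> \<le> \<mu>" by (rule lim_part_leI) fact
  show "\<mu> \<le> lim_part \<delta>"
  proof (rule ccontr)
    assume "\<not> \<mu> \<le> lim_part \<delta>"
    then have "lim_part \<delta> < \<mu>" by simp
    moreover have "{lim_part \<delta>..<\<mu>} \<subseteq> {lim_part \<delta>..<\<delta>}" using assms(2) by auto
    ultimately show False using assms(1) finite_lim_part finite_subset limit_def by blast
  qed
qed

lemma lim_part_limit: "limit \<mu> \<Longrightarrow> lim_part \<mu> = \<mu>"
  by (rule lim_part_eqI) auto

lemma lim_part_mono:
  fixes x y :: "'o::wellorder"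
  assumes "x \<le> y" shows "lim_part x \<le> lim_part y"
proof (cases "lim_part y \<le> x")
  case True
  have "finite {lim_part y..<x}" by (rule finite_subset[OF _ finite_lim_part[of y]]) (use assms in auto)
  then show ?thesis by (rule lim_part_leI)
next
  case False
  then show ?thesis using lim_part_le[of x] by simp
qed

lemma fin_part_less:
  fixes x y :: "'o::wellorder"
  assumes "x < y" "lim_part x = lim_part y"
  shows "fin_part x < fin_part y"
proof -
  have "{lim_part y..<x} \<subseteq> {lim_part y..<y}" "x \<notin> {lim_part y..<x}" "x \<in> {lim_part y..<y}"
    using assms lim_part_le[of x] by auto
  then have "{lim_part y..<x} \<subset> {lim_part y..<y}" by blast
  then show ?thesis unfolding fin_part_def assms(2) using finite_lim_part psubset_card_mono by blast
qed

lemma least_less_lim_part: "infinite {..<\<delta>} \<Longrightarrow> least < lim_part \<delta>"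
  by (metis finite_lim_part least_le lessThan_eq_least order.strict_iff_order)

text \<open>Only multisets of limits denote ordinals.\<close>

definition mless :: "'o::wellorder multiset \<Rightarrow> 'o multiset \<Rightarrow> bool" where
  "mless M N \<longleftrightarrow> M < N \<and> (\<forall>x\<in>#M. limit x)"

text \<open>\<open>2\<^sup>\<delta> = 2\<^sup>\<lambda> \<cdot> 2\<^sup>n\<close> for \<open>\<delta> = \<lambda> + n\<close>.\<close>

definition pow2 :: "'o::wellorder \<Rightarrow> 'o multiset" where
  "pow2 \<delta> = replicate_mset (2 ^ fin_part \<delta>) (lim_part \<delta>)"

text \<open>An entry above \<mu> occurs more often in \<open>M\<close> than in \<open>N\<close>; the
  multiset order would then need a still larger entry in \<open>N\<close>.\<close>

lemma less_multiset_elems_le: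
  fixes M N :: "'o::linorder multiset"
  assumes "M < N" "\<forall>x\<in>#N. x \<le> \<mu>"
  shows "\<forall>x\<in>#M. x \<le> \<mu>"
proof (rule ballI, rule ccontr)
  fix x assume x: "x \<in># M" "\<not> x \<le> \<mu>"
  then have "count N x < count M x" using assms(2) by (metis count_greater_zero_iff count_inI)
  then obtain y where "x < y" "count M y < count N y" using assms(1) less_multiset\<^sub>H\<^sub>O by metis
  then have "y \<in># N" by (metis count_eq_zero_iff less_nat_zero_code)
  then show False using \<open>x < y\<close> x(2) assms(2) by force
qed

text \<open>As 2^\<mu> is a power of \<omega> for a limit \<mu>, multisets of limits are Cantor
  normal forms; this describes the forms below 2^\<mu> * k.\<close>

lemma less_replicate_mset_iff:
  fixes M :: "'o::linorder multiset"
  shows "M < replicate_mset k \<mu> \<longleftrightarrow> (\<forall>x\<in>#M. x \<le> \<mu>) \<and> count M \<mu> < k"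
proof
  assume *: "M < replicate_mset k \<mu>"
  have "\<not> replicate_mset k \<mu> \<subseteq># M" using * subset_eq_imp_le_multiset leD by blast
  then show "(\<forall>x\<in>#M. x \<le> \<mu>) \<and> count M \<mu> < k"
    using less_multiset_elems_le[OF *, of \<mu>]
    by (auto simp flip: count_le_replicate_mset_subset_eq split: if_splits)
next
  assume M: "(\<forall>x\<in>#M. x \<le> \<mu>) \<and> count M \<mu> < k"
  show "M < replicate_mset k \<mu>"
    unfolding less_multiset\<^sub>H\<^sub>O
  proof (intro conjI allI impI)
    show "M \<noteq> replicate_mset k \<mu>" using M by auto
    fix y assume y: "count (replicate_mset k \<mu>) y < count M y"
    then have "y \<in># M" by (metis count_eq_zero_iff less_nat_zero_code)
    moreover have "y \<noteq> \<mu>" using y M by auto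
    ultimately have "y < \<mu>" using M by (simp add: order.strict_iff_order)
    then show "\<exists>x>y. count M x < count (replicate_mset k \<mu>) x" using M by auto
  qed
qed

lemma mless_trans: "mless L M \<Longrightarrow> M \<le> N \<Longrightarrow> mless L N"
  by (auto simp: mless_def)

section \<open>Widths of unions and of consecutive families\<close>

text \<open>The natural sum of the widths bounds the width of a union. If both parts fail, no move
  in \<open>X\<close> reaches some \<open>a'\<close> below \<open>a\<close>, and no move in
  \<open>Y\<close> some \<open>b'\<close> below \<open>b\<close>. A move in the union that answers
  both \<open>a' + b\<close> and \<open>a + b'\<close> lies in one part, where the induction
  hypothesis gives a contradiction.\<close>

lemma width_ge_Un_imp:
  fixes a b :: "'o::wellorder multiset"
  assumes "width_ge le mless (X \<union> Y) (a + b)" "\<forall>x\<in>#a. limit x" "\<forall>x\<in>#b. limit x"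
  shows "width_ge le mless X a \<or> width_ge le mless Y b"
  using assms
proof (induction "a + b" arbitrary: X Y a b rule: less_induct)
  case less
  show ?case
  proof (rule ccontr)
    assume neg: "\<not> ?thesis"
    then obtain a' b' where a': "mless a' a" "\<And>x. x \<in> X \<Longrightarrow> \<not> width_ge le mless (residual le X x) a'"
      and b': "mless b' b" "\<And>y. y \<in> Y \<Longrightarrow> \<not> width_ge le mless (residual le Y y) b'"
      using width_ge_iff by metis
    have lt: "a' + b < a + b" "a + b' < a + b" using a'(1) b'(1) by (auto simp: mless_def)
    have lims: "\<forall>x\<in>#a'. limit x" "\<forall>x\<in>#b'. limit x" using a'(1) b'(1) by (auto simp: mless_def)
    \<comment> \<open>The maximum, so that one move \<open>z\<close> serves whichever part contains
      it.\<close>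
    define c where "c = max (a' + b) (a + b')"
    have "mless c (a + b)"
      using lt lims less.prems by (auto simp: c_def mless_def max_def)
    then obtain z where z: "z \<in> X \<union> Y" "width_ge le mless (residual le (X \<union> Y) z) c"
      using less.prems(1) width_geD by metis
    have eq: "residual le (X \<union> Y) z = residual le X z \<union> residual le Y z"
      by (auto simp: residual_def)
    have sub: "residual le X z \<subseteq> X" "residual le Y z \<subseteq> Y" by (auto simp: residual_def)
    show False
    proof (cases "z \<in> X")
      case True
      have "width_ge le mless (residual le X z \<union> residual le Y z) (a' + b)"
        by (rule width_ge_weaken[OF z(2)[unfolded eq]]) (auto intro: mless_trans simp: c_def)
      then show False using less.hyps[OF lt(1)] lims less.prems a'(2)[OF True] neg width_ge_mono sub by metis
    next
      case False
      then have "z \<in> Y" using z by blast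
      have "width_ge le mless (residual le X z \<union> residual le Y z) (a + b')"
        by (rule width_ge_weaken[OF z(2)[unfolded eq]]) (auto intro: mless_trans simp: c_def)
      then show False using less.hyps[OF lt(2)] lims less.prems b'(2)[OF \<open>z \<in> Y\<close>] neg width_ge_mono sub by metis
    qed
  qed
qed

text \<open>Additive indecomposability of 2^\<mu>: if both parts fail, they already fail at ordinals
  below 2^\<mu>, whose natural sum is still below it.\<close>

lemma width_ge_Un_single:
  fixes \<mu> :: "'o::wellorder"
  assumes "width_ge le mless (X \<union> Y) {#\<mu>#}" "least < \<mu>"
  shows "width_ge le mless X {#\<mu>#} \<or> width_ge le mless Y {#\<mu>#}"
proof (rule ccontr)
  assume neg: "\<not> ?thesis"
  then obtain a b where a: "mless a {#\<mu>#}" "\<And>x. x \<in> X \<Longrightarrow> \<not> width_ge le mless (residual le X x) a"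
      and b: "mless b {#\<mu>#}" "\<And>y. y \<in> Y \<Longrightarrow> \<not> width_ge le mless (residual le Y y) b"
    using width_ge_iff by metis
  \<comment> \<open>The entry \<open>least\<close> is 2^0 = 1, so these are a + 1 and b + 1, bounds
    that the two parts fail to reach.\<close>
  let ?a = "add_mset least a" and ?b = "add_mset least b"
  have "mless a ?a" "mless b ?b" using a(1) b(1) by (auto simp: mless_def)
  then have "\<not> width_ge le mless X ?a" "\<not> width_ge le mless Y ?b"
    using a(2) b(2) width_geD by metis+
  moreover have "?a + ?b < {#\<mu>#}" using a(1) b(1) assms(2) by (auto simp: mless_def)
  then have "width_ge le mless (X \<union> Y) (?a + ?b)"
    by (intro width_ge_weaken[OF assms(1)]) (auto intro: mless_trans)
  ultimately show False using width_ge_Un_imp[of le X Y ?a ?b] a(1) b(1) limit_least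
    by (auto simp: mless_def)
qed

lemma width_ge_UN_single:
  fixes \<mu> :: "'o::wellorder"
  assumes "finite I" "width_ge le mless (X \<union> (\<Union>i\<in>I. Y i)) {#\<mu>#}" "least < \<mu>"
    "\<And>i. i \<in> I \<Longrightarrow> \<not> width_ge le mless (Y i) {#\<mu>#}"
  shows "width_ge le mless X {#\<mu>#}"
  using assms
proof (induction I arbitrary: X rule: finite_induct)
  case (insert i I)
  have "width_ge le mless ((X \<union> (\<Union>i\<in>I. Y i)) \<union> Y i) {#\<mu>#}"
    using insert.prems(1) by (simp add: Un_ac)
  then have "width_ge le mless (X \<union> (\<Union>i\<in>I. Y i)) {#\<mu>#}"
    using width_ge_Un_single insert.prems by (metis insertI1)
  then show ?case using insert by blast
qed simp

text \<open>Play in \<open>U\<close> first, recording the played elements in \<open>Q\<close>, then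
  move on to what \<open>Q\<close> leaves of \<open>V\<close>. Since the entries of \<open>m\<close>
  are at most \<mu>, the multiset sum is the ordinal sum 2^\<mu> * k + m, whose last summand is used
  up first.\<close>

lemma width_ge_append:
  fixes m :: "'o::wellorder multiset"
  assumes "width_ge le mless U m" "U \<subseteq> U0" "\<forall>x\<in>#m. x \<le> \<mu>" "finite Q" "Q \<subseteq> U0"
    and V: "\<And>Q. finite Q \<Longrightarrow> Q \<subseteq> U0 \<Longrightarrow>
      width_ge le mless {v \<in> V. \<forall>q\<in>Q. \<not> le q v \<and> \<not> le v q} (replicate_mset k \<mu>)"
  shows "width_ge le mless (U \<union> {v \<in> V. \<forall>q\<in>Q. \<not> le q v \<and> \<not> le v q}) (replicate_mset k \<mu> + m)"
  using assms(1-5)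
proof (induction arbitrary: Q rule: width_ge.induct)
  case (step m U)
  let ?V = "\<lambda>Q. {v \<in> V. \<forall>q\<in>Q. \<not> le q v \<and> \<not> le v q}"
  show ?case
  proof (rule width_ge.step, intro allI impI)
    fix c assume c: "mless c (replicate_mset k \<mu> + m)"
    have c_le: "\<forall>x\<in>#c. x \<le> \<mu>"
      by (rule less_multiset_elems_le[of c "replicate_mset k \<mu> + m"])
        (use c step.prems in \<open>auto simp: mless_def\<close>)
    show "\<exists>x\<in>U \<union> ?V Q. width_ge le mless (residual le (U \<union> ?V Q) x) c"
    \<comment> \<open>With fewer than k copies of \<mu>, \<open>c\<close> is within reach of
      \<open>V\<close> alone; otherwise \<open>c\<close> contains all k copies and only
      \<open>m\<close> has decreased.\<close>
    proof (cases "count c \<mu> < k")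
      case True
      then have "mless c (replicate_mset k \<mu>)"
        using c c_le by (auto simp: mless_def less_replicate_mset_iff)
      then obtain z where "z \<in> ?V Q" "width_ge le mless (residual le (?V Q) z) c"
        by (rule width_geD[OF V[OF step.prems(3,4)]])
      moreover from this(2) have "width_ge le mless (residual le (U \<union> ?V Q) z) c"
        by (rule width_ge_mono[OF _ residual_mono]) auto
      ultimately show ?thesis by blast
    next
      case False
      then have "replicate_mset k \<mu> \<subseteq># c" by (simp flip: count_le_replicate_mset_subset_eq)
      then obtain m' where m': "c = replicate_mset k \<mu> + m'" using subset_mset.le_iff_add by metis
      then have "mless m' m" using c by (auto simp: mless_def)
      from step.IH[rule_format, OF this]
      obtain x where x: "x \<in> U" and IH: "residual le U x \<subseteq> U0 \<longrightarrow> (\<forall>x\<in>#m'. x \<le> \<mu>) \<longrightarrow>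
         (\<forall>Q. finite Q \<longrightarrow> Q \<subseteq> U0 \<longrightarrow>
           width_ge le mless (residual le U x \<union> ?V Q) (replicate_mset k \<mu> + m'))"
        by (elim bexE conjE) (rule that)
      have "width_ge le mless (residual le U x \<union> ?V (insert x Q)) (replicate_mset k \<mu> + m')"
        using step.prems x c_le by (intro IH[rule_format]) (auto simp: m' residual_def)
      then have "width_ge le mless (residual le (U \<union> ?V Q) x) c"
        unfolding m' by (rule width_ge_mono) (auto simp: residual_def)
      then show ?thesis using x by blast
    qed
  qed
qed

section \<open>Finite bounds and finite descents\<close>

text \<open>Translates a finite bound n into multiset notation, where it is n copies of 2^0.\<close>

lemma width_ge_finite:
  fixes \<delta> :: "'o::wellorder"
  assumes "width_ge le (<) A \<delta>" "finite {least..<\<delta>}"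
  shows "width_ge le mless A (replicate_mset (card {least..<\<delta>}) (least :: 'o))"
  using assms
proof (induction rule: width_ge.induct)
  case (step \<delta> A)
  show ?case
  proof (rule width_ge.step, intro allI impI)
    fix M assume "mless M (replicate_mset (card {least..<\<delta>}) (least :: 'o))"
    then have M: "\<forall>x\<in>#M. x \<le> least" "count M least < card {least..<\<delta>}"
      by (auto simp: mless_def less_replicate_mset_iff)
    then have "\<forall>x\<in>#M. x = least" using least_le antisym by blast
    then have Meq: "M = replicate_mset (count M least) least"
      by (intro multiset_eqI) (metis count_eq_zero_iff count_replicate_mset)
    have "least < \<delta>" using M(2) least_le[of \<delta>] by (cases "least = \<delta>") auto
    then obtain \<delta>' where \<delta>': "\<delta>' < \<delta>" "finite {least..<\<delta>'}" "card {least..<\<delta>'} = count M least"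
      using exists_card_atLeastLessThan[OF _ M(2)] by blast
    with step.IH[rule_format, OF \<delta>'(1)]
    show "\<exists>x\<in>A. width_ge le mless (residual le A x) M" by (subst Meq) auto
  qed
qed

text \<open>Finitely many moves descend from \<delta> to \<mu>; the elements played form
  \<open>X\<close>.\<close>

lemma width_ge_antichain:
  fixes \<mu> \<delta> :: "'o::wellorder"
  assumes "width_ge le (<) A \<delta>" "\<forall>a\<in>A. le a a" "\<mu> \<le> \<delta>" "finite {\<mu>..<\<delta>}"
  shows "\<exists>X. finite X \<and> card X = card {\<mu>..<\<delta>} \<and> X \<subseteq> A \<and> (\<forall>x\<in>X. \<forall>y\<in>X. x \<noteq> y \<longrightarrow> \<not> le x y)
    \<and> width_ge le (<) {a \<in> A. \<forall>x\<in>X. \<not> le a x \<and> \<not> le x a} \<mu>"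
  using assms
proof (induction "card {\<mu>..<\<delta>}" arbitrary: A \<delta>)
  case 0
  then have "\<mu> = \<delta>" by auto
  then show ?case using 0 by (intro exI[of _ "{}"]) auto
next
  case (Suc n)
  then have "\<mu> < \<delta>" by (cases "\<mu> = \<delta>") auto
  then obtain \<delta>' where \<delta>': "\<mu> \<le> \<delta>'" "\<delta>' < \<delta>" "finite {\<mu>..<\<delta>'}" "card {\<mu>..<\<delta>'} = n"
    using exists_card_atLeastLessThan[of \<mu> \<delta> n] Suc.hyps(2) by auto
  from Suc.prems(1) \<delta>'(2) obtain a where a: "a \<in> A" "width_ge le (<) (residual le A a) \<delta>'"
    by (rule width_geD)
  obtain X where X: "finite X" "card X = n" "X \<subseteq> residual le A a"
    "\<forall>x\<in>X. \<forall>y\<in>X. x \<noteq> y \<longrightarrow> \<not> le x y"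
    "width_ge le (<) {z \<in> residual le A a. \<forall>x\<in>X. \<not> le z x \<and> \<not> le x z} \<mu>"
    using Suc.hyps(1)[of \<delta>' "residual le A a"] a Suc.prems(2) \<delta>' by (auto simp: residual_def)
  have "a \<notin> X" using X(3) Suc.prems(2) a(1) by (auto simp: residual_def)
  show ?case
  proof (intro exI[of _ "insert a X"] conjI)
    show "card (insert a X) = card {\<mu>..<\<delta>}" using X \<open>a \<notin> X\<close> Suc.hyps(2) by simp
    show "width_ge le (<) {z \<in> A. \<forall>x\<in>insert a X. \<not> le z x \<and> \<not> le x z} \<mu>"
      by (rule width_ge_mono[OF X(5)]) (auto simp: residual_def)
  qed (use X a in \<open>auto simp: residual_def\<close>)
qed

section \<open>The finitary powerset\<close>

lemma wqo_on_subset: "wqo_on A le \<Longrightarrow> B \<subseteq> A \<Longrightarrow> wqo_on B le"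
  unfolding wqo_on_def qo_on_def by (meson subsetD)

text \<open>Otherwise the removal of up-closures of chosen elements could go on forever, and these
  elements would form a bad sequence.\<close>

lemma wqo_on_minimal_subset:
  assumes "wqo_on B le" "P B"
  shows "\<exists>D\<subseteq>B. P D \<and> (\<forall>x\<in>D. \<not> P {d \<in> D. \<not> le x d})"
proof (rule ccontr)
  assume neg: "\<not> ?thesis"
  define nx where "nx D = (SOME x. x \<in> D \<and> P {d \<in> D. \<not> le x d})" for D
  have nxt: "nx D \<in> D" "P {d \<in> D. \<not> le (nx D) d}" if "D \<subseteq> B" "P D" for D
    using someI_ex[of "\<lambda>x. x \<in> D \<and> P {d \<in> D. \<not> le x d}"] neg that unfolding nx_def by blast+
  define F where "F i = ((\<lambda>D. {d \<in> D. \<not> le (nx D) d}) ^^ i) B" for i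
  have F0: "F 0 = B" and FS: "F (Suc i) = {d \<in> F i. \<not> le (nx (F i)) d}" for i
    by (auto simp: F_def)
  have FB: "F i \<subseteq> B \<and> P (F i)" for i
  proof (induction i)
    case 0 then show ?case using assms F0 by simp
  next
    case (Suc i) then show ?case using nxt(2)[of "F i"] FS[of i] by auto
  qed
  have anti: "F j \<subseteq> F i" if "i \<le> j" for i j
    using that by (rule lift_Suc_antimono_le[rotated]) (auto simp: FS)
  have "nx (F j) \<in> F (Suc i)" if "i < j" for i j
    using nxt(1)[of "F j"] FB[of j] that anti[of "Suc i" j] by auto
  then have "\<not> le (nx (F i)) (nx (F j))" if "i < j" for i j using that FS by blast
  moreover have "\<forall>i. nx (F i) \<in> B" using nxt(1) FB by blast
  then have "\<exists>i j. i < j \<and> le (nx (F i)) (nx (F j))"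
    using assms(1)[unfolded wqo_on_def, THEN conjunct2, rule_format, of "\<lambda>i. nx (F i)"] by simp
  ultimately show False by blast
qed

text \<open>For a minimal \<open>D\<close>, the sets avoiding the up-closure of an \<open>x\<close>
  in \<open>D\<close> can be discarded by indecomposability. The remaining sets have an element
  above \<open>x\<close>; if \<open>x\<close> is not below any element of \<open>T\<close>, neither
  is that element.\<close>

lemma width_ge_Pf_residual_family:
  fixes \<mu> :: "'o::wellorder"
  assumes B: "wqo_on B le" and w: "width_ge (hoare le) mless (Pf B) {#\<mu>#}" and \<mu>: "least < \<mu>"
  shows "\<exists>D\<subseteq>B. \<forall>T. finite T \<longrightarrow> T \<subseteq> D \<longrightarrow>
    width_ge (hoare le) mless {S \<in> Pf D. \<exists>d\<in>S. \<forall>t\<in>T. \<not> le d t} {#\<mu>#}"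
proof -
  let ?w = "\<lambda>F. width_ge (hoare le) mless F {#\<mu>#}"
  obtain D where D: "D \<subseteq> B" "?w (Pf D)" "\<And>x. x \<in> D \<Longrightarrow> \<not> ?w (Pf {d \<in> D. \<not> le x d})"
    using wqo_on_minimal_subset[of B le "\<lambda>D. ?w (Pf D)"] B w by blast
  have trans: "le x z" if "le x y" "le y z" "x \<in> D" "y \<in> D" "z \<in> D" for x y z
    using B D(1) that unfolding wqo_on_def qo_on_def by blast
  show ?thesis
  proof (intro exI[of _ D] conjI allI impI)
    fix T assume T: "finite T" "T \<subseteq> D"
    show "?w {S \<in> Pf D. \<exists>d\<in>S. \<forall>t\<in>T. \<not> le d t}"
    proof (cases "\<exists>x\<in>D. \<forall>t\<in>T. \<not> le x t")
      case True
      then obtain x where x: "x \<in> D" "\<forall>t\<in>T. \<not> le x t" by blast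
      have "Pf D \<subseteq> {S \<in> Pf D. \<exists>d\<in>S. \<forall>t\<in>T. \<not> le d t} \<union> Pf {d \<in> D. \<not> le x d}"
      proof
        fix S assume S: "S \<in> Pf D"
        show "S \<in> {S \<in> Pf D. \<exists>d\<in>S. \<forall>t\<in>T. \<not> le d t} \<union> Pf {d \<in> D. \<not> le x d}"
        proof (cases "\<exists>d\<in>S. le x d")
          case True
          then obtain d where d: "d \<in> S" "le x d" by blast
          then have "\<forall>t\<in>T. \<not> le d t" using trans[of x d] x T S by (auto simp: Pf_def)
          then show ?thesis using d S by blast
        next
          case False
          then show ?thesis using S by (auto simp: Pf_def)
        qed
      qed
      then show ?thesis using width_ge_Un_single[OF width_ge_mono[OF D(2)] \<mu>] D(3)[OF x(1)] by blast
    next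
      case False
      txt \<open>Now \<open>T\<close> dominates \<open>D\<close>, so any two sets that dominate \<open>T\<close> are equivalent; but the
        sets dominating \<open>T\<close> have width at least \<open>2\<^sup>\<mu>\<close>.\<close>
      have "Pf D \<subseteq> {S \<in> Pf D. \<forall>t\<in>T. \<exists>d\<in>S. le t d} \<union> (\<Union>t\<in>T. Pf {d \<in> D. \<not> le t d})"
        by (auto simp: Pf_def)
      from width_ge_UN_single[OF T(1) width_ge_mono[OF D(2) this] \<mu>] D(3) T(2)
      have "?w {S \<in> Pf D. \<forall>t\<in>T. \<exists>d\<in>S. le t d}" by blast
      \<comment> \<open>\<open>{#least#}\<close> and \<open>{#}\<close> denote 1 and 0; descending
        through them yields two incomparable sets \<open>S\<close> and \<open>S'\<close>.\<close>
      moreover have "mless {#least::'o#} {#\<mu>#}" using \<mu> limit_least by (auto simp: mless_def)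
      ultimately obtain S where "S \<in> {S \<in> Pf D. \<forall>t\<in>T. \<exists>d\<in>S. le t d}"
        and wS: "width_ge (hoare le) mless (residual (hoare le) {S \<in> Pf D. \<forall>t\<in>T. \<exists>d\<in>S. le t d} S) {#least::'o#}"
        by (rule width_geD)
      then have S: "S \<in> Pf D" by blast
      have "mless {#} {#least::'o#}" by (auto simp: mless_def)
      with wS obtain S' where "S' \<in> residual (hoare le) {S \<in> Pf D. \<forall>t\<in>T. \<exists>d\<in>S. le t d} S"
        by (rule width_geD)
      then have S': "\<forall>t\<in>T. \<exists>d\<in>S'. le t d" "S' \<in> Pf D" "\<not> hoare le S S'"
        by (auto simp: residual_def)
      have "\<exists>b\<in>S'. le a b" if a: "a \<in> S" for a
      proof -
        obtain t where t: "t \<in> T" "le a t" using False S a by (auto simp: Pf_def)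
        then obtain b where "b \<in> S'" "le t b" using S'(1) by blast
        then show ?thesis using trans[of a t b] a t S S'(2) T(2) by (auto simp: Pf_def)
      qed
      then show ?thesis using S'(3) by (auto simp: hoare_def)
    qed
  qed (rule D(1))
qed

text \<open>A further element \<open>x\<close> of the antichain doubles the bound: sets with
  \<open>x\<close> are played first, then sets without it. The latter keep their width, because the
  finitely many elements of \<open>D\<close> used so far can be added to \<open>T\<close>.\<close>

lemma width_ge_Pf_times_antichain:
  fixes \<mu> :: "'o::wellorder"
  assumes D: "\<And>T. finite T \<Longrightarrow> T \<subseteq> D \<Longrightarrow>
      width_ge (hoare le) mless {S \<in> Pf D. \<exists>d\<in>S. \<forall>t\<in>T. \<not> le d t} {#\<mu>#}"
    and "finite X" "\<forall>x\<in>X. \<forall>y\<in>X. x \<noteq> y \<longrightarrow> \<not> le x y"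
    "\<forall>x\<in>X. \<forall>d\<in>D. \<not> le x d \<and> \<not> le d x" "finite T" "T \<subseteq> D"
  shows "width_ge (hoare le) mless {S \<union> Y | S Y. S \<in> Pf D \<and> (\<exists>d\<in>S. \<forall>t\<in>T. \<not> le d t) \<and> Y \<subseteq> X}
    (replicate_mset (2 ^ card X) \<mu>)"
  using assms(2-)
proof (induction X arbitrary: T rule: finite_induct)
  case empty
  then show ?case using D[of T] by simp
next
  case (insert x X)
  let ?G = "\<lambda>T X. {S \<union> Y | S Y. S \<in> Pf D \<and> (\<exists>d\<in>S. \<forall>t\<in>T. \<not> le d t) \<and> Y \<subseteq> X}"
  let ?M = "replicate_mset (2 ^ card X) \<mu>"
  let ?U = "insert x ` ?G T X" and ?V = "?G T X"
  have IH: "width_ge (hoare le) mless (?G T' X) ?M" if "finite T'" "T' \<subseteq> D" for T'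
    using insert.IH[of T'] insert.prems that by auto
  \<comment> \<open>Hence a set containing \<open>x\<close> is never below a set of the family
    without \<open>x\<close>.\<close>
  have x_le: "\<not> le x z" if "z \<in> S \<union> Y" "S \<subseteq> D" "Y \<subseteq> X" for z S Y
  proof -
    have "z \<in> D \<or> z \<in> X \<and> x \<noteq> z" using that insert.hyps by blast
    then show ?thesis using insert.prems(1,2) by blast
  qed
  have G: "finite y \<and> y \<subseteq> D \<union> X" if y: "y \<in> ?G T X" for y
  proof -
    from y obtain S Y where "y = S \<union> Y" "S \<in> Pf D" "Y \<subseteq> X" by blast
    then show ?thesis using insert.hyps(1) finite_subset by (auto simp: Pf_def)
  qed
  have wU: "width_ge (hoare le) mless ?U ?M"
  proof (rule width_ge_embed[OF IH[OF insert.prems(3,4)]])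
    fix y z assume yz: "y \<in> ?G T X" "z \<in> ?G T X" "\<not> hoare le y z" "\<not> hoare le z y"
    \<comment> \<open>Inserting \<open>x\<close> creates no new comparability, since nothing in
      \<open>D\<close> or \<open>X\<close> lies below \<open>x\<close>.\<close>
    have "\<not> hoare le (insert x y) (insert x z)"
      if y: "y \<in> ?G T X" and nle: "\<not> hoare le y z" for y z
    proof
      assume "hoare le (insert x y) (insert x z)"
      moreover obtain a where a: "a \<in> y" "\<forall>b\<in>z. \<not> le a b" using nle by (auto simp: hoare_def)
      ultimately have "le a x" by (auto simp: hoare_def)
      moreover have "a \<in> D \<union> X" using a(1) y by (auto simp: Pf_def)
      ultimately show False using insert.prems(1,2) insert.hyps by auto
    qed
    then show "\<not> hoare le (insert x y) (insert x z) \<and> \<not> hoare le (insert x z) (insert x y)"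
      using yz by blast
  qed (rule order.refl)
  have wV: "width_ge (hoare le) mless {v \<in> ?V. \<forall>q\<in>Q. \<not> hoare le q v \<and> \<not> hoare le v q} ?M"
    if Q: "finite Q" "Q \<subseteq> ?U" for Q
  proof -
    \<comment> \<open>A set with a member of \<open>D\<close> that is not below anything in
      \<open>T'\<close> cannot be below a set of \<open>Q\<close>: that member is incomparable to
      \<open>x\<close> and to all of \<open>X\<close>.\<close>
    define T' where "T' = T \<union> (\<Union>Q \<inter> D)"
    have "finite (\<Union>Q)"
    proof (rule finite_Union[OF Q(1)])
      fix q assume "q \<in> Q"
      from subsetD[OF Q(2) this] obtain y where "q = insert x y" "y \<in> ?G T X" by (rule imageE)
      then show "finite q" using G by simp
    qed
    then have T': "finite T'" "T' \<subseteq> D" using insert.prems by (auto simp: T'_def)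
    show "width_ge (hoare le) mless {v \<in> ?V. \<forall>q\<in>Q. \<not> hoare le q v \<and> \<not> hoare le v q} ?M"
    proof (rule width_ge_mono[OF IH[OF T']], rule subsetI)
      fix v assume "v \<in> ?G T' X"
      then obtain S Y d where v: "v = S \<union> Y" "S \<in> Pf D" "Y \<subseteq> X" "d \<in> S" "\<forall>t\<in>T'. \<not> le d t"
        by blast
      have "\<not> hoare le q v \<and> \<not> hoare le v q" if "q \<in> Q" for q
      proof
        from subsetD[OF Q(2) that] obtain y where y: "q = insert x y" "y \<in> ?G T X" by (rule imageE)
        then show "\<not> hoare le q v" using x_le[of _ S Y] v by (auto simp: hoare_def Pf_def)
        have "q \<subseteq> D \<union> insert x X" using y(1) G[OF y(2)] by blast
        moreover have "\<not> le d b" if "b \<in> q" "b \<in> D" for b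
          using that \<open>q \<in> Q\<close> v(5) by (auto simp: T'_def)
        moreover have "\<not> le d b" if "b \<in> insert x X" for b
          using that insert.prems(2) v(2,4) by (auto simp: Pf_def)
        ultimately have "\<not> le d b" if "b \<in> q" for b
          using that by blast
        then show "\<not> hoare le v q" using v(1,4) by (auto simp: hoare_def)
      qed
      moreover have "\<exists>d\<in>S. \<forall>t\<in>T. \<not> le d t" using v(4,5) by (auto simp: T'_def)
      then have "v \<in> ?V" using v(1-3) by blast
      ultimately show "v \<in> {v \<in> ?V. \<forall>q\<in>Q. \<not> hoare le q v \<and> \<not> hoare le v q}" by blast
    qed
  qed
  \<comment> \<open>Nothing has been played at the start, so \<open>Q\<close> is empty.\<close>
  have wUV: "width_ge (hoare le) mless
    (?U \<union> {v \<in> ?V. \<forall>q\<in>{}. \<not> hoare le q v \<and> \<not> hoare le v q}) (?M + ?M)"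
    by (rule width_ge_append[OF wU order.refl _ _ _ wV]) simp_all
  have sub: "?U \<union> {v \<in> ?V. \<forall>q\<in>{}. \<not> hoare le q v \<and> \<not> hoare le v q} \<subseteq> ?G T (insert x X)"
  proof (intro Un_least subsetI)
    fix u assume "u \<in> ?U"
    then obtain S Y where "u = S \<union> insert x Y" "S \<in> Pf D" "\<exists>d\<in>S. \<forall>t\<in>T. \<not> le d t" "Y \<subseteq> X"
      by auto
    then show "u \<in> ?G T (insert x X)" by blast
  qed blast
  have eq: "?M + ?M = replicate_mset (2 ^ card (insert x X)) \<mu>"
    using insert.hyps by (simp add: mult_2 multiset_eq_iff)
  show ?case using width_ge_mono[OF wUV sub] unfolding eq .
qed

lemma width_ge_Pf_singletons:
  "width_ge le r A \<alpha> \<Longrightarrow> width_ge (hoare le) r (Pf A) \<alpha>"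
  by (rule width_ge_embed[where le = le and f = "\<lambda>x. {x}"]) (auto simp: Pf_def hoare_def)

text \<open>Induction on \<delta>, by suprema at limits and by an antichain of size
  \<open>fin_part \<delta>\<close> otherwise. For finite n >= 1 the bound fails: an n-element
  antichain has fewer than 2^n pairwise incomparable subsets, as the empty set is comparable to
  all.\<close>

lemma width_ge_Pf:
  fixes \<delta> :: "'o::wellorder"
  assumes "wqo_on B le" "infinite {..<\<delta>}" "width_ge le (<) B \<delta>"
  shows "width_ge (hoare le) mless (Pf B) (pow2 \<delta>)"
  using assms
proof (induction \<delta> arbitrary: B rule: less_induct)
  case (less \<delta>)
  note pos = least_less_lim_part[OF less.prems(2)]
  show ?case
  proof (cases "lim_part \<delta> = \<delta>")
    case True
    then have lim: "limit \<delta>" and pos': "least < \<delta>" using limit_lim_part pos by metis+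
    have pow: "pow2 \<delta> = {#\<delta>#}" by (simp add: pow2_def fin_part_def True)
    show ?thesis unfolding pow
    proof (rule width_ge.step, intro allI impI)
      fix M assume M: "mless M {#\<delta>#}"
      \<comment> \<open>The largest entry of \<open>M\<close>, or 0 if \<open>M\<close> is
        empty.\<close>
      obtain \<mu> where \<mu>: "\<forall>x\<in>#M. x \<le> \<mu>" "limit \<mu>" "\<mu> < \<delta>"
      proof (cases "M = {#}")
        case True
        then show ?thesis using that[of least] pos' limit_least by auto
      next
        case False
        then show ?thesis using that[of "Max_mset M"] M by (auto simp: mless_def)
      qed
      \<comment> \<open>Both j and 2^j exceed the number of copies of \<mu> in \<open>M\<close>; so
        for \<delta>' = \<mu> + j, the bound j (if \<delta>' is finite) or
        \<open>pow2 \<delta>'\<close> (if not) exceeds \<open>M\<close>.\<close>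
      define j where "j = Suc (count M \<mu>)"
      obtain \<delta>' where \<delta>': "\<mu> \<le> \<delta>'" "\<delta>' < \<delta>" "finite {\<mu>..<\<delta>'}" "card {\<mu>..<\<delta>'} = j"
        using exists_card_atLeastLessThan[OF \<mu>(3), of j] lim \<mu>(3) by (auto simp: limit_def)
      have lp: "lim_part \<delta>' = \<mu>" using lim_part_eqI \<mu>(2) \<delta>' by blast
      have w': "width_ge le (<) B \<delta>'"
        by (rule width_ge_weaken[OF less.prems(3)]) (use \<delta>'(2) in auto)
      obtain N where N: "mless M N" "width_ge (hoare le) mless (Pf B) N"
      proof (cases "finite {..<\<delta>'}")
        case True
        \<comment> \<open>The induction hypothesis covers only infinite ordinals; here singletons
          already give enough width.\<close>
        then have fin: "finite {least..<\<delta>'}" by (simp add: lessThan_eq_least)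
        have "\<mu> = least" using lim_part_leI[OF fin] lp least_le antisym by blast
        then have "mless M (replicate_mset (card {least..<\<delta>'}) least)"
          using M \<mu>(1) \<delta>'(4)
          by (simp add: mless_def less_replicate_mset_iff j_def del: replicate_mset_Suc)
        then show ?thesis using that width_ge_Pf_singletons[OF width_ge_finite[OF w' fin]] by blast
      next
        case False
        have "count M \<mu> < 2 ^ j" unfolding j_def by (meson Suc_lessD less_exp)
        then have "mless M (pow2 \<delta>')"
          using M \<mu>(1) \<delta>'(4) lp by (auto simp: mless_def pow2_def fin_part_def less_replicate_mset_iff)
        then show ?thesis using that less.IH[OF \<delta>'(2) less.prems(1) False w'] by blast
      qed
      from N(2,1) show "\<exists>S\<in>Pf B. width_ge (hoare le) mless (residual (hoare le) (Pf B) S) M"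
        by (rule width_geD) blast
    qed
  next
    case False
    let ?\<mu> = "lim_part \<delta>"
    have lt: "?\<mu> < \<delta>" using False lim_part_le[of \<delta>] by simp
    have refl: "\<forall>b\<in>B. le b b" using less.prems(1) by (auto simp: wqo_on_def qo_on_def)
    obtain X where X: "finite X" "card X = fin_part \<delta>" "X \<subseteq> B" "\<forall>x\<in>X. \<forall>y\<in>X. x \<noteq> y \<longrightarrow> \<not> le x y"
      and w: "width_ge le (<) {a \<in> B. \<forall>x\<in>X. \<not> le a x \<and> \<not> le x a} ?\<mu>"
      using width_ge_antichain[OF less.prems(3) refl lim_part_le finite_lim_part]
      unfolding fin_part_def by blast
    let ?B = "{a \<in> B. \<forall>x\<in>X. \<not> le a x \<and> \<not> le x a}"
    have B: "wqo_on ?B le" by (rule wqo_on_subset[OF less.prems(1)]) blast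
    have "infinite {..<?\<mu>}"
    proof
      assume "finite {..<?\<mu>}"
      then have "finite ({..<?\<mu>} \<union> {?\<mu>..<\<delta>})" using finite_lim_part by blast
      moreover have "{..<?\<mu>} \<union> {?\<mu>..<\<delta>} = {..<\<delta>}" using lt by auto
      ultimately show False using less.prems(2) by simp
    qed
    from less.IH[OF lt B this w] have "width_ge (hoare le) mless (Pf ?B) {#?\<mu>#}"
      by (simp add: pow2_def fin_part_def lim_part_limit limit_lim_part)
    from width_ge_Pf_residual_family[OF B this pos] obtain D where D: "D \<subseteq> ?B"
      "\<And>T. finite T \<Longrightarrow> T \<subseteq> D \<Longrightarrow>
        width_ge (hoare le) mless {S \<in> Pf D. \<exists>d\<in>S. \<forall>t\<in>T. \<not> le d t} {#?\<mu>#}"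
      by blast
    have "width_ge (hoare le) mless {S \<union> Y | S Y. S \<in> Pf D \<and> (\<exists>d\<in>S. \<forall>t\<in>{}. \<not> le d t) \<and> Y \<subseteq> X}
      (replicate_mset (2 ^ card X) ?\<mu>)"
      by (rule width_ge_Pf_times_antichain[OF D(2) X(1,4)]) (use D(1) in auto)
    then show ?thesis unfolding pow2_def X(2)[symmetric]
      by (rule width_ge_mono) (use D(1) X(1,3) in \<open>auto simp: Pf_def intro: finite_subset\<close>)
  qed
qed

section \<open>Sums of distinct powers of two\<close>

text \<open>With n = \<open>fin_part \<delta>\<close>, entries equal to
  \<open>lim_part \<delta>\<close> come only from \<open>z\<close> with that limit part. Their
  finite parts are distinct and below n, so there are at most 2^0 + ... + 2^(n-1) such
  entries.\<close>

lemma sum_pow2_less: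
  fixes \<delta> :: "'o::wellorder"
  assumes "finite Z" "\<forall>z\<in>Z. z < \<delta>"
  shows "(\<Sum>z\<in>Z. pow2 z) < pow2 \<delta>"
proof -
  have "\<forall>x\<in>#(\<Sum>z\<in>Z. pow2 z). x \<le> lim_part \<delta>"
    using assms(1) less_imp_le[OF assms(2)[rule_format]]
    by (auto simp: pow2_def set_mset_sum split: if_splits intro!: lim_part_mono)
  moreover have "count (\<Sum>z\<in>Z. pow2 z) (lim_part \<delta>) < 2 ^ fin_part \<delta>"
  proof -
    let ?Z = "{z \<in> Z. lim_part z = lim_part \<delta>}"
    have inj: "inj_on fin_part ?Z"
      by (rule linorder_inj_onI) (use fin_part_less in fastforce)+
    have "count (\<Sum>z\<in>Z. pow2 z) (lim_part \<delta>) = (\<Sum>z\<in>Z. if lim_part z = lim_part \<delta> then 2 ^ fin_part z else 0)"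
      by (auto simp: count_sum pow2_def intro: sum.cong)
    also have "\<dots> = (\<Sum>z\<in>?Z. 2 ^ fin_part z)"
      using assms(1) by (simp add: sum.inter_filter)
    also have "\<dots> = (\<Sum>i\<in>fin_part ` ?Z. 2 ^ i)"
      by (simp add: sum.reindex[OF inj])
    also have "\<dots> \<le> (\<Sum>i\<in>{..<fin_part \<delta>}. 2 ^ i)"
      by (rule sum_mono2) (use assms(2) fin_part_less in auto)
    also have "(\<Sum>i\<in>{..<n}. 2 ^ i) < (2::nat) ^ n" for n
      by (induction n) simp_all
    finally show ?thesis .
  qed
  ultimately show ?thesis by (simp add: pow2_def less_replicate_mset_iff)
qed

text \<open>After cancelling the common part, the power at \<delta> alone outweighs
  \<open>Z - Z'\<close>. This is the comparison at the largest difference in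
  \<open>oexp2\<close>.\<close>

lemma sum_pow2_strict_mono:
  fixes Z Z' :: "'o::wellorder set"
  assumes "finite Z" "finite Z'" "\<delta> \<in> Z' - Z" "\<forall>z\<in>(Z - Z') \<union> (Z' - Z). z \<le> \<delta>"
  shows "(\<Sum>z\<in>Z. pow2 z) < (\<Sum>z\<in>Z'. pow2 z)"
proof -
  have "(\<Sum>z\<in>Z - Z'. pow2 z) < pow2 \<delta>"
    by (rule sum_pow2_less) (use assms in \<open>auto simp: order.strict_iff_order\<close>)
  also have "pow2 \<delta> \<subseteq># (\<Sum>z\<in>Z' - Z. pow2 z)"
    using assms by (simp add: sum.remove)
  then have "pow2 \<delta> \<le> (\<Sum>z\<in>Z' - Z. pow2 z)" by (rule subset_eq_imp_le_multiset)
  finally have "(\<Sum>z\<in>Z \<inter> Z'. pow2 z) + (\<Sum>z\<in>Z - Z'. pow2 z)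
      < (\<Sum>z\<in>Z' \<inter> Z. pow2 z) + (\<Sum>z\<in>Z' - Z. pow2 z)"
    by (simp add: Int_commute)
  then show ?thesis using assms(1,2) by (simp add: sum.Int_Diff[symmetric])
qed

section \<open>Order types and the trees\<close>

lemma Well_order_if_ordIso: "(r, s) \<in> ordIso \<Longrightarrow> Well_order r"
  by (auto simp: ordIso_def)

\<comment> \<open>Provides a type of class \<open>wellorder\<close> to which the results above
  apply. It contains the order type of W itself, which no element of \<open>Field W\<close>
  represents.\<close>
quotient_type 'b ordinal = "'b rel" / partial: "\<lambda>r s. (r, s) \<in> ordIso"
proof (rule part_equivpI)
  show "\<exists>r :: 'b rel. (r, r) \<in> ordIso" using ordIso_reflexive[of "{}"] by auto
qed (auto intro!: sympI transpI intro: ordIso_symmetric ordIso_transitive)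

instantiation ordinal :: (type) wellorder
begin

lift_definition less_eq_ordinal :: "'b ordinal \<Rightarrow> 'b ordinal \<Rightarrow> bool" is "\<lambda>r s. (r, s) \<in> ordLeq"
  by (meson ordIso_ordLeq_trans ordIso_symmetric ordLeq_ordIso_trans)

lift_definition less_ordinal :: "'b ordinal \<Rightarrow> 'b ordinal \<Rightarrow> bool" is "\<lambda>r s. (r, s) \<in> ordLess"
  by (meson ordIso_ordLess_trans ordIso_symmetric ordLess_ordIso_trans)

instance
proof
  fix x y z :: "'b ordinal"
  show "x < y \<longleftrightarrow> x \<le> y \<and> \<not> y \<le> x"
    by transfer (metis not_ordLess_ordLeq ordIso_iff_ordLeq ordLeq_iff_ordLess_or_ordIso)
  show "x \<le> x" by transfer (simp add: ordIso_iff_ordLeq)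
  show "x \<le> y \<Longrightarrow> y \<le> z \<Longrightarrow> x \<le> z" by transfer (rule ordLeq_transitive)
  show "x \<le> y \<Longrightarrow> y \<le> x \<Longrightarrow> x = y" by transfer (simp add: ordIso_iff_ordLeq)
  show "x \<le> y \<or> y \<le> x" by transfer (intro ordLeq_total Well_order_if_ordIso)
next
  fix P :: "'b ordinal \<Rightarrow> bool" and a :: "'b ordinal"
  assume *: "\<And>x. (\<And>y. y < x \<Longrightarrow> P y) \<Longrightarrow> P x"
  have "wf {(x :: 'b ordinal, y). x < y}"
  proof (rule wf_subset[OF wf_inv_image[OF wf_ordLess]])
    show "{(x :: 'b ordinal, y). x < y} \<subseteq> inv_image ordLess rep_ordinal"
      by (auto simp: less_ordinal_def)
  qed
  then show "P a" using * by (induction a rule: wf_induct_rule) blast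
qed

end

text \<open>The empty well-order is the default, since values must lie in the domain of the partial
  equivalence.\<close>

lift_definition otype :: "'b rel \<Rightarrow> 'b ordinal" is "\<lambda>r. if Well_order r then r else {}"
  by (auto intro: ordIso_reflexive)

lemma otype_less_iff: "Well_order r \<Longrightarrow> Well_order s \<Longrightarrow> otype r < otype s \<longleftrightarrow> (r, s) \<in> ordLess"
  by transfer simp

lemma otype_eq_iff: "Well_order r \<Longrightarrow> Well_order s \<Longrightarrow> otype r = otype s \<longleftrightarrow> (r, s) \<in> ordIso"
  by transfer simp

lemma otype_surj: "\<exists>r. Well_order r \<and> x = otype r"
  proof (transfer)
  fix r :: "'b rel" assume "(r, r) \<in> ordIso"
  then show "\<exists>s :: 'b rel. Well_order s \<and> (r, if Well_order s then s else {}) \<in> ordIso"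
    using Well_order_if_ordIso by (intro exI[of _ r]) auto
qed


text \<open>The ordinal that \<open>Some y\<close> stands for in \<open>below\<close>.\<close>

definition position :: "'b rel \<Rightarrow> 'b \<Rightarrow> 'b ordinal" where
  "position W y = otype (Restr W (underS W y))"

lemma position_less_otype:
  assumes "Well_order W" "y \<in> Field W"
  shows "position W y < otype W"
  unfolding position_def using assms underS_Restr_ordLess[of W y]
  by (subst otype_less_iff) (auto simp: Well_order_Restr)

lemma less_otypeE:
  assumes "Well_order W" "\<beta> < otype W"
  obtains y where "y \<in> Field W" "\<beta> = position W y"
proof -
  obtain r where r: "Well_order r" "\<beta> = otype r" using otype_surj by blast
  with assms have "(r, W) \<in> ordLess" by (simp add: otype_less_iff)
  with assms(1) r(1) obtain y where "y \<in> Field W" "(r, Restr W (underS W y)) \<in> ordIso"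
    using ordLess_iff_ordIso_Restr by blast
  then show ?thesis using that r assms(1) by (simp add: position_def otype_eq_iff Well_order_Restr)
qed

lemma position_less_iff:
  assumes W: "Well_order W" and "x \<in> Field W" "y \<in> Field W"
  shows "position W y < position W x \<longleftrightarrow> (y, x) \<in> W \<and> y \<noteq> x"
proof -
  have wo: "wo_rel W" using W by (simp add: wo_rel_def)
  have "position W y < position W x \<longleftrightarrow> underS W y \<subset> underS W x"
    unfolding position_def using W
    by (simp add: otype_less_iff Well_order_Restr wo_rel.underS_ofilter[OF wo] flip: ofilter_subset_ordLess)
  also have "\<dots> \<longleftrightarrow> (y, x) \<in> W \<and> (x, y) \<notin> W"
    using underS_incl_iff[OF wo_rel.LIN[OF wo]] assms(2,3) by (auto simp: less_le_not_le)
  also have "\<dots> \<longleftrightarrow> (y, x) \<in> W \<and> y \<noteq> x"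
    using wo_rel.ANTISYM[OF wo] wo_rel.REFL[OF wo] assms(2) by (auto simp: antisym_def refl_on_def)
  finally show ?thesis .
qed

lemma inj_on_position: "Well_order W \<Longrightarrow> inj_on (position W) (Field W)"
  by (rule inj_onI) (metis less_irrefl position_less_iff wo_rel.TOTALS wo_rel_def)

section \<open>Ranks of trees and widths\<close>

lemma inco_tree_Nil [simp]: "[] \<in> inco_tree A le"
  by (simp add: inco_tree_def)

lemma inco_tree_snoc:
  "u @ [z] \<in> inco_tree A le \<longleftrightarrow>
    u \<in> inco_tree A le \<and> z \<in> A \<and> (\<forall>v\<in>set u. \<not> le v z \<and> \<not> le z v)"
proof
  assume *: "u @ [z] \<in> inco_tree A le"
  then have nth: "\<not> le ((u @ [z]) ! i) ((u @ [z]) ! j) \<and> \<not> le ((u @ [z]) ! j) ((u @ [z]) ! i)"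
    if "i < j" "j \<le> length u" for i j using that by (simp add: inco_tree_def)
  have "\<not> le (u ! i) z \<and> \<not> le z (u ! i)" if "i < length u" for i
    using nth[of i "length u"] that by (simp add: nth_append)
  moreover have "u \<in> inco_tree A le"
    using * nth by (simp add: inco_tree_def) (metis less_imp_le_nat nth_append order_less_trans)
  ultimately show "u \<in> inco_tree A le \<and> z \<in> A \<and> (\<forall>v\<in>set u. \<not> le v z \<and> \<not> le z v)"
    using * by (auto simp: inco_tree_def in_set_conv_nth)
qed (auto simp: inco_tree_def nth_append less_Suc_eq)

text \<open>A node \<open>u\<close> is represented by the set \<open>?R u\<close> of its possible
  continuations; passing to a child takes a residual.\<close>

lemma width_ge_if_tree_rank_ge:
  assumes W: "Well_order W" and "tree_rank_ge (inco_tree A le) W"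
  shows "width_ge le (<) A (otype W)"
proof -
  obtain S where S: "([], None) \<in> S"
    "\<And>u x y. (u, x) \<in> S \<Longrightarrow> below W x y \<Longrightarrow> \<exists>z. u @ [z] \<in> inco_tree A le \<and> (u @ [z], Some y) \<in> S"
    using assms(2) unfolding tree_rank_ge_def by blast
  let ?R = "\<lambda>u. {a \<in> A. \<forall>v\<in>set u. \<not> le v a \<and> \<not> le a v}"
  have ind: "width_ge le (<) (?R u) \<alpha>"
    if "(u, x) \<in> S" "case x of None \<Rightarrow> \<alpha> = otype W | Some y \<Rightarrow> y \<in> Field W \<and> \<alpha> = position W y" for \<alpha> u x
    using that
  proof (induction \<alpha> arbitrary: u x rule: less_induct)
    case (less \<alpha>)
    show ?case
    proof (rule width_ge.step, intro allI impI)
      fix \<beta> assume \<beta>: "\<beta> < \<alpha>"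
      then have "\<beta> < otype W"
        using less.prems(2) position_less_otype[OF W] by (auto split: option.splits intro: less_trans)
      then obtain y where y: "y \<in> Field W" "\<beta> = position W y" using less_otypeE[OF W] by blast
      then have "below W x y" using \<beta> less.prems(2) position_less_iff[OF W]
        by (auto simp: below_def split: option.splits)
      then obtain z where z: "u @ [z] \<in> inco_tree A le" "(u @ [z], Some y) \<in> S"
        using S(2) less.prems(1) by blast
      have "width_ge le (<) (?R (u @ [z])) \<beta>" by (rule less.IH[OF \<beta> z(2)]) (simp add: y)
      moreover have "?R (u @ [z]) = residual le (?R u) z" by (auto simp: residual_def)
      ultimately show "\<exists>a\<in>?R u. width_ge le (<) (residual le (?R u) a) \<beta>"
        using z(1) by (auto simp: inco_tree_snoc)
    qed
  qed
  show ?thesis using ind[OF S(1), of "otype W"] by simp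
qed

text \<open>The converse for any ordinal notation: \<phi> turns labels into notations, and moves can
  be found as long as \<phi> decreases along \<open>below\<close>.\<close>

lemma tree_rank_ge_if_width_ge:
  assumes "width_ge le r A (\<phi> None)" "\<And>x y. below R x y \<Longrightarrow> r (\<phi> (Some y)) (\<phi> x)"
  shows "tree_rank_ge (inco_tree A le) R"
proof -
  let ?R = "\<lambda>u. {a \<in> A. \<forall>v\<in>set u. \<not> le v a \<and> \<not> le a v}"
  define S where "S = {(u, x). u \<in> inco_tree A le \<and> width_ge le r (?R u) (\<phi> x)}"
  have "\<exists>z. u @ [z] \<in> inco_tree A le \<and> (u @ [z], Some y) \<in> S" if S: "(u, x) \<in> S" and y: "below R x y" for u x y
  proof -
    have u: "u \<in> inco_tree A le" "width_ge le r (?R u) (\<phi> x)" using S by (auto simp: S_def)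
    from u(2) assms(2)[OF y] obtain z where z: "z \<in> ?R u" "width_ge le r (residual le (?R u) z) (\<phi> (Some y))"
      by (rule width_geD)
    have "residual le (?R u) z = ?R (u @ [z])" by (auto simp: residual_def)
    then show ?thesis using u(1) z by (intro exI[of _ z]) (simp add: S_def inco_tree_snoc)
  qed
  moreover have "([], None) \<in> S" using assms(1) by (simp add: S_def)
  ultimately show ?thesis unfolding tree_rank_ge_def by blast
qed

text \<open>A finite set \<open>X\<close> denotes the ordinal with binary digit 1 exactly at the
  positions of \<open>X\<close>; \<open>?\<phi>\<close> evaluates this expansion, and a descent in
  \<open>oexp2\<close> lowers the value.\<close>

lemma tree_rank_ge_oexp2:
  assumes W: "Well_order W" and "width_ge le mless A (pow2 (otype W))"
  shows "tree_rank_ge (inco_tree A le) (oexp2 W)"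
proof (rule tree_rank_ge_if_width_ge)
  let ?\<phi> = "\<lambda>x. case x of None \<Rightarrow> pow2 (otype W) | Some X \<Rightarrow> \<Sum>z\<in>position W ` X. pow2 z"
  show "width_ge le mless A (?\<phi> None)" using assms(2) by simp
  fix x Y assume Y: "below (oexp2 W) x Y"
  then have finY: "finite Y" "Y \<subseteq> Field W" by (auto simp: below_def oexp2_def Field_def)
  have "(\<Sum>z\<in>position W ` Y. pow2 z) < ?\<phi> x"
  proof (cases x)
    case None
    then show ?thesis using finY position_less_otype[OF W] by (auto intro!: sum_pow2_less)
  next
    case (Some X)
    then have X: "finite X" "X \<subseteq> Field W" and "\<exists>y\<in>X - Y. \<forall>z\<in>(Y - X) \<union> (X - Y). (z, y) \<in> W"
      using Y by (auto simp: below_def oexp2_def)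
    then obtain y where y: "y \<in> X - Y" "\<forall>z\<in>(Y - X) \<union> (X - Y). (z, y) \<in> W" by blast
    have inj: "inj_on (position W) (X \<union> Y)"
      using inj_on_position[OF W] X(2) finY(2) by (meson Un_least inj_on_subset)
    have "position W z \<le> position W y" if "z \<in> (Y - X) \<union> (X - Y)" for z
    proof (cases "z = y")
      case False
      then show ?thesis using that y position_less_iff[OF W, of y z] X(2) finY(2) by (auto intro: less_imp_le)
    qed simp
    moreover have "position W ` Y - position W ` X = position W ` (Y - X)"
      "position W ` X - position W ` Y = position W ` (X - Y)"
      using inj by (auto simp: inj_on_def)
    ultimately have "(\<Sum>z\<in>position W ` Y. pow2 z) < (\<Sum>z\<in>position W ` X. pow2 z)"
      using X finY y(1) by (intro sum_pow2_strict_mono[of _ _ "position W y"]) auto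
    then show ?thesis using Some by simp
  qed
  then show "mless (?\<phi> (Some Y)) (?\<phi> x)"
    using finY(1) by (auto simp: mless_def pow2_def set_mset_sum limit_lim_part split: if_splits)
qed

section \<open>Finite width\<close>

text \<open>Following the labels k - 1, ..., 0 downwards produces a branch with k entries.\<close>

lemma tree_rank_ge_natW_imp_antichain:
  assumes "tree_rank_ge (inco_tree A le) (natW k)"
  obtains u where "u \<in> inco_tree A le" "length u = k"
proof -
  obtain S where S: "([], None) \<in> S"
    "\<And>u x y. (u, x) \<in> S \<Longrightarrow> below (natW k) x y \<Longrightarrow>
      \<exists>z. u @ [z] \<in> inco_tree A le \<and> (u @ [z], Some y) \<in> S"
    using assms unfolding tree_rank_ge_def by blast
  have field: "Field (natW k) = {..<k}" by (auto simp: natW_def Field_def)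
  \<comment> \<open>At depth j the remaining rank is k - j; at the root, k is written
    \<open>None\<close>.\<close>
  have "\<exists>u. u \<in> inco_tree A le \<and> length u = j \<and> (u, if j = 0 then None else Some (k - j)) \<in> S"
    if "j \<le> k" for j
    using that
  proof (induction j)
    case 0
    then show ?case using S(1) by auto
  next
    case (Suc j)
    then obtain u where u: "length u = j" "(u, if j = 0 then None else Some (k - j)) \<in> S" by auto
    have "below (natW k) (if j = 0 then None else Some (k - j)) (k - Suc j)"
      using Suc.prems by (auto simp: below_def field) (auto simp: natW_def)
    from S(2)[OF u(2) this] obtain z where "u @ [z] \<in> inco_tree A le" "(u @ [z], Some (k - Suc j)) \<in> S"
      by blast
    then show ?case using u(1) by (intro exI[of _ "u @ [z]"]) simp
  qed
  then show ?thesis using that by blast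
qed

text \<open>Sending i to \<open>u ! i\<close> embeds the k-element antichain into \<open>A\<close>;
  direct images then embed its finite subsets for the Hoare order, so branches are mapped entry by
  entry.\<close>

lemma tree_rank_le_tree_Pf_antichain:
  assumes u: "u \<in> inco_tree A le" "length u = k" and refl: "\<forall>a\<in>A. le a a"
  shows "tree_rank_le_tree (inco_tree (Pf {0..<k}) (hoare (=))) (inco_tree (Pf A) (hoare le))"
proof -
  let ?f = "\<lambda>X. (!) u ` X"
  have uA: "u ! i \<in> A" if "i < k" for i using u that by (auto simp: inco_tree_def)
  have le_iff: "le (u ! i) (u ! j) \<longleftrightarrow> i = j" if "i < k" "j < k" for i j
  proof (cases i j rule: linorder_cases)
    case equal
    then show ?thesis using refl uA that by simp
  qed (use u that in \<open>simp_all add: inco_tree_def\<close>)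
  have hoare_iff: "hoare le (?f X) (?f Y) \<longleftrightarrow> hoare (=) X Y" if "X \<in> Pf {0..<k}" "Y \<in> Pf {0..<k}" for X Y
  proof -
    have "le (u ! i) (u ! j) \<longleftrightarrow> i = j" if "i \<in> X" "j \<in> Y" for i j
      using that \<open>X \<in> _\<close> \<open>Y \<in> _\<close> by (intro le_iff) (auto simp: Pf_def)
    then show ?thesis by (simp add: hoare_def)
  qed
  define S where "S = {(v, map ?f v) | v. v \<in> inco_tree (Pf {0..<k}) (hoare (=)) \<and> map ?f v \<in> inco_tree (Pf A) (hoare le)}"
  have "map ?f v @ [?f z] \<in> inco_tree (Pf A) (hoare le)"
    if "map ?f v \<in> inco_tree (Pf A) (hoare le)" "v @ [z] \<in> inco_tree (Pf {0..<k}) (hoare (=))" for v z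
  proof -
    have "set v \<subseteq> Pf {0..<k}" "z \<in> Pf {0..<k}" using that(2) by (auto simp: inco_tree_def)
    moreover have "?f z \<in> Pf A" using \<open>z \<in> Pf {0..<k}\<close> uA by (auto simp: Pf_def)
    ultimately show ?thesis using that hoare_iff by (auto simp: inco_tree_snoc subset_iff)
  qed
  then have "\<exists>z'. map ?f v @ [z'] \<in> inco_tree (Pf A) (hoare le) \<and> (v @ [z], map ?f v @ [z']) \<in> S"
    if "(v, map ?f v) \<in> S" "v @ [z] \<in> inco_tree (Pf {0..<k}) (hoare (=))" for v z
    using that by (intro exI[of _ "?f z"]) (auto simp: S_def)
  moreover have "([], []) \<in> S" by (simp add: S_def)
  moreover have "v' = map ?f v" if "(v, v') \<in> S" for v v' using that by (auto simp: S_def)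
  ultimately show ?thesis unfolding tree_rank_le_tree_def by (intro exI[of _ S]) metis
qed

theorem mainTheorem3:
  fixes A :: "'a set" and le :: "'a \<Rightarrow> 'a \<Rightarrow> bool"
  assumes "wqo_on A le"
  shows "(\<forall>W :: 'b rel. Well_order W \<longrightarrow> tree_rank_eq (inco_tree A le) W \<longrightarrow> infinite (Field W)
            \<longrightarrow> tree_rank_ge (inco_tree (Pf A) (hoare le)) (oexp2 W))
       \<and> (\<forall>k::nat. tree_rank_eq (inco_tree A le) (natW k)
            \<longrightarrow> tree_rank_le_tree (inco_tree (Pf {0..<k}) (hoare (=)))
                                  (inco_tree (Pf A) (hoare le)))"
proof (intro conjI allI impI)
  fix W :: "'b rel"
  assume W: "Well_order W" "tree_rank_eq (inco_tree A le) W" "infinite (Field W)"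
  have "position W ` Field W \<subseteq> {..<otype W}" using position_less_otype[OF W(1)] by blast
  then have "infinite {..<otype W}"
    using W(3) inj_on_position[OF W(1)] finite_imageD finite_subset by blast
  moreover have "width_ge le (<) A (otype W)"
    by (rule width_ge_if_tree_rank_ge[OF W(1)]) (use W(2) in \<open>simp add: tree_rank_eq_def\<close>)
  ultimately show "tree_rank_ge (inco_tree (Pf A) (hoare le)) (oexp2 W)"
    by (intro tree_rank_ge_oexp2[OF W(1)] width_ge_Pf[OF assms])
next
  fix k assume "tree_rank_eq (inco_tree A le) (natW k)"
  then obtain u where "u \<in> inco_tree A le" "length u = k"
    using tree_rank_ge_natW_imp_antichain unfolding tree_rank_eq_def by blast
  then show "tree_rank_le_tree (inco_tree (Pf {0..<k}) (hoare (=))) (inco_tree (Pf A) (hoare le))"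
    using assms by (intro tree_rank_le_tree_Pf_antichain) (auto simp: wqo_on_def qo_on_def)
qed

end
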